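(* Let $T$ be the $\aleph_0$-regular tree. The usual inner product is, up to a scalar multiple, the unique $\lambda\big(\mathrm{Aut}(T)\big)$-invariant inner product on $\ell_2(T)$. (Here an inner product on $\ell_2(T)$ is not assumed to induce a norm equivalent to the usual one.)
   Context: The $\aleph_0$-regular tree $T$ is the countable tree (connected, acyclic simple graph) in which every vertex has infinitely many neighbours; $T$ also denotes its vertex set, and $\mathrm{Aut}(T)$ is its group of graph automorphisms. $\ell_2(T)$ is the complex Hilbert space of square-summable functions $T\to\mathbb C$, and $\lambda(g)(x)=x(g^{-1}\,\cdot\,)$ for $g\in\mathrm{Aut}(T)$. An inner product $\langle\cdot|\cdot\rangle'$ is $\lambda(\mathrm{Aut}(T))$-invariant if $\langle\lambda(g)x|\lambda(g)y\rangle'=\langle x|y\rangle'$ for all $g\in \mathrm{Aut}(T)$ and $x,y\in\ell_2(T)$. *)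

theory Defs
  imports "HOL-Analysis.Analysis"
begin

text \<open>
  A simple graph is given by its adjacency relation; its vertex set is the whole type \<open>'v\<close>.
\<close>

definition simple_graph :: "('v \<Rightarrow> 'v \<Rightarrow> bool) \<Rightarrow> bool" where
  "simple_graph adj \<longleftrightarrow> symp adj \<and> irreflp adj"

definition connected_graph :: "('v \<Rightarrow> 'v \<Rightarrow> bool) \<Rightarrow> bool" where
  "connected_graph adj \<longleftrightarrow> (\<forall>u v. adj\<^sup>*\<^sup>* u v)"

text \<open>A cycle is the list of its (at least three, pairwise distinct) vertices.\<close>

definition graph_cycle :: "('v \<Rightarrow> 'v \<Rightarrow> bool) \<Rightarrow> 'v list \<Rightarrow> bool" where
  "graph_cycle adj p \<longleftrightarrow>
     3 \<le> length p \<and> distinct p \<and> successively adj p \<and> adj (last p) (hd p)"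

definition graph_tree :: "('v \<Rightarrow> 'v \<Rightarrow> bool) \<Rightarrow> bool" where
  "graph_tree adj \<longleftrightarrow>
     simple_graph adj \<and> connected_graph adj \<and> (\<nexists>p. graph_cycle adj p)"

definition aleph0_regular_tree :: "('v \<Rightarrow> 'v \<Rightarrow> bool) \<Rightarrow> bool" where
  "aleph0_regular_tree adj \<longleftrightarrow>
     countable (UNIV :: 'v set) \<and> graph_tree adj \<and> (\<forall>v. infinite {w. adj v w})"

definition graph_Aut :: "('v \<Rightarrow> 'v \<Rightarrow> bool) \<Rightarrow> ('v \<Rightarrow> 'v) set" where
  "graph_Aut adj = {g. bij g \<and> (\<forall>u v. adj (g u) (g v) \<longleftrightarrow> adj u v)}"

definition ell2 :: "('v \<Rightarrow> complex) set" where
  "ell2 = {x. (\<lambda>v. (cmod (x v))\<^sup>2) summable_on UNIV}"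

definition ell2_inner :: "('v \<Rightarrow> complex) \<Rightarrow> ('v \<Rightarrow> complex) \<Rightarrow> complex" where
  "ell2_inner x y = (\<Sum>\<^sub>\<infinity>v. x v * cnj (y v))"

definition lam :: "('v \<Rightarrow> 'v) \<Rightarrow> ('v \<Rightarrow> complex) \<Rightarrow> ('v \<Rightarrow> complex)" where
  "lam g x = (\<lambda>v. x (inv g v))"

text \<open>
  Inner products on a complex linear subspace \<open>S\<close> of the space of all functions, linear in the
  first argument. No continuity is required. By conjugate symmetry \<open>ip x x\<close> is real, so
  positivity is a statement about its real part. The values of \<open>ip\<close> outside \<open>S\<close> are irrelevant.
\<close>

definition inner_product_on ::
  "('v \<Rightarrow> complex) set \<Rightarrow> (('v \<Rightarrow> complex) \<Rightarrow> ('v \<Rightarrow> complex) \<Rightarrow> complex) \<Rightarrow> bool" where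
  "inner_product_on S ip \<longleftrightarrow>
     (\<forall>x\<in>S. \<forall>y\<in>S. \<forall>z\<in>S. ip (\<lambda>v. x v + y v) z = ip x z + ip y z) \<and>
     (\<forall>a. \<forall>x\<in>S. \<forall>y\<in>S. ip (\<lambda>v. a * x v) y = a * ip x y) \<and>
     (\<forall>x\<in>S. \<forall>y\<in>S. ip y x = cnj (ip x y)) \<and>
     (\<forall>x\<in>S. x \<noteq> (\<lambda>_. 0) \<longrightarrow> 0 < Re (ip x x))"

definition lam_Aut_invariant ::
  "('v \<Rightarrow> 'v \<Rightarrow> bool) \<Rightarrow> (('v \<Rightarrow> complex) \<Rightarrow> ('v \<Rightarrow> complex) \<Rightarrow> complex) \<Rightarrow> bool" where
  "lam_Aut_invariant adj ip \<longleftrightarrow>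
     (\<forall>g\<in>graph_Aut adj. \<forall>x\<in>ell2. \<forall>y\<in>ell2. ip (lam g x) (lam g y) = ip x y)"

text \<open>
  The next facts confirm that \<open>ell2\<close> is a linear subspace preserved by \<open>lam g\<close>, and that the
  infinite sum defining \<open>ell2_inner\<close> converges on it.
\<close>

lemma ell2_scale: "x \<in> ell2 \<Longrightarrow> (\<lambda>v. a * x v) \<in> ell2"
  by (auto simp: ell2_def norm_mult power_mult_distrib intro: summable_on_cmult_right)

lemma ell2_add:
  assumes "x \<in> ell2" "y \<in> ell2"
  shows "(\<lambda>v. x v + y v) \<in> ell2"
proof -
  have "(\<lambda>v. 2 * (cmod (x v))\<^sup>2 + 2 * (cmod (y v))\<^sup>2) summable_on UNIV"
    using assms by (auto simp: ell2_def intro!: summable_on_add summable_on_cmult_right)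
  moreover have "(cmod (x v + y v))\<^sup>2 \<le> 2 * (cmod (x v))\<^sup>2 + 2 * (cmod (y v))\<^sup>2" for v
  proof -
    have "(cmod (x v + y v))\<^sup>2 \<le> (cmod (x v) + cmod (y v))\<^sup>2"
      by (intro power_mono norm_triangle_ineq) auto
    also have "\<dots> \<le> 2 * (cmod (x v))\<^sup>2 + 2 * (cmod (y v))\<^sup>2"
      using sum_squares_bound[of "cmod (x v)" "cmod (y v)"] by (simp add: power2_sum)
    finally show ?thesis .
  qed
  ultimately show ?thesis
    unfolding ell2_def mem_Collect_eq by (rule summable_on_comparison_test) auto
qed

lemma ell2_inner_summable:
  assumes "x \<in> ell2" "y \<in> ell2"
  shows "(\<lambda>v. x v * cnj (y v)) summable_on UNIV"
proof -
  have "(\<lambda>v. (cmod (x v))\<^sup>2 + (cmod (y v))\<^sup>2) summable_on UNIV"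
    using assms by (auto simp: ell2_def intro!: summable_on_add)
  moreover have "norm (x v * cnj (y v)) \<le> (cmod (x v))\<^sup>2 + (cmod (y v))\<^sup>2" for v
  proof -
    have "0 \<le> cmod (x v) * cmod (y v)" by simp
    then show ?thesis
      using sum_squares_bound[of "cmod (x v)" "cmod (y v)"]
      unfolding norm_mult complex_mod_cnj mult.assoc by linarith
  qed
  ultimately have "(\<lambda>v. norm (x v * cnj (y v))) summable_on UNIV"
    by (rule summable_on_comparison_test) auto
  then show ?thesis
    by (rule abs_summable_summable)
qed

lemma lam_ell2:
  assumes "bij g" "x \<in> ell2"
  shows "lam g x \<in> ell2"
  using summable_on_reindex_bij_betw[OF bij_imp_bij_inv[OF assms(1)],
      of "\<lambda>v. (cmod (x v))\<^sup>2"] assms(2)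
  by (simp add: ell2_def lam_def)

end

theory Submission
  imports Defs
begin

text \<open>
  Besides transitivity of the automorphism group on vertices, the proof uses only the symmetry of the
  branches at a vertex \<open>r\<close>: removing \<open>r\<close> leaves countably many isomorphic branches, and every
  permutation of them is realised by an automorphism fixing \<open>r\<close> and all branches that stay in place
  (\<open>branch_index_exists\<close>, from coordinates on the tree by lists of naturals, \<open>tree_chart_exists\<close>).

  The key fact is that a linear functional on \<open>ell2\<close>, continuous or not, that is invariant under the
  automorphisms acting only inside an infinite set \<open>B\<close> of branches vanishes on the functions
  supported on \<open>B\<close> (\<open>invariant_functional_vanishes\<close>). Indeed, averaging two translations that push the
  support of a function into disjoint places shrinks its norm by the factor \<open>1 / sqrt 2\<close>; by a
  Neumann series, the function is a finite sum of differences \<open>h - lam g h\<close>.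

  Applied to \<open>\<lambda>x. ip x y\<close> for an invariant inner product \<open>ip\<close>, this has two consequences. First,
  \<open>ip x (delta v) = c * x v\<close> for all \<open>x\<close>, with a constant \<open>c > 0\<close> that does not depend on \<open>v\<close> because
  automorphisms act transitively (\<open>ip_delta\<close>). So \<open>ip\<close> is \<open>c\<close> times the usual inner product as soon
  as one argument has finite support, and truncation gives \<open>c * \<parallel>x\<parallel>\<^sup>2 \<le> ip x x\<close> in general. Second,
  functions supported on complementary infinite sets of branches are orthogonal for \<open>ip\<close>.

  The remaining inequality \<open>ip x x \<le> c * \<parallel>x\<parallel>\<^sup>2\<close> is proved for \<open>x\<close> supported on an infinite, co-infinite
  set of branches by a gliding hump argument (\<open>sqnorm_le_on_branches\<close>): otherwise suitable multiples
  of the tails of \<open>x\<close>, transported to disjoint sets of branches, would sum to a vector of \<open>ell2\<close> whose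
  \<open>ip\<close>-length exceeds every bound. Splitting the branches into two such sets gives
  \<open>ip x x = c * \<parallel>x\<parallel>\<^sup>2\<close> for all \<open>x\<close>, and polarization finishes the proof.
\<close>

section \<open>Coordinates on the tree\<close>

text \<open>
  Two different paths between the same vertices diverge somewhere; up to the first point where they
  meet again, they bound a cycle.
\<close>

lemma acyclic_unique_path:
  assumes sym: "symp adj" and acyc: "\<nexists>c. graph_cycle adj c"
    and "p \<noteq> []" "q \<noteq> []" "distinct p" "distinct q"
    and "successively adj p" "successively adj q" "hd p = hd q" "last p = last q"
  shows "p = q"
  using assms(3-)
proof (induction p arbitrary: q)
  case Nil
  then show ?case by simp
next
  case (Cons v p)
  from Cons.prems obtain q' where q: "q = v # q'"
    by (cases q) auto
  show ?case
  proof (cases "p = [] \<or> q' = []")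
    case True
    then show ?thesis
      using Cons.prems q by (cases p; cases q') (auto split: if_splits)
  next
    case False
    then have ne: "p \<noteq> []" "q' \<noteq> []" by auto
    show ?thesis
    proof (cases "hd p = hd q'")
      case True
      have "p = q'"
        using Cons.prems q ne True by (intro Cons.IH) (auto simp: successively_Cons)
      then show ?thesis using q by simp
    next
      case neq: False
      have "last p \<in> set q'"
        using Cons.prems(8) q ne by simp
      then have "\<exists>x\<in>set p. x \<in> set q'"
        using ne by (meson last_in_set)
      then obtain a z a' where p: "p = a @ z # a'" "z \<in> set q'" "\<forall>x\<in>set a. x \<notin> set q'"
        using split_list_first_prop[of p "\<lambda>x. x \<in> set q'"] by blast
      then obtain b b' where q': "q' = b @ z # b'"
        by (meson split_list)
      have "graph_cycle adj (v # a @ z # rev b)"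
        unfolding graph_cycle_def
      proof (intro conjI)
        have "a \<noteq> [] \<or> b \<noteq> []"
          using neq p q' by auto
        then show "3 \<le> length (v # a @ z # rev b)"
          by (cases a; cases b) auto
        show "distinct (v # a @ z # rev b)"
          using Cons.prems(3,4) p q q' by auto
        have adjs: "adj x y \<longleftrightarrow> adj y x" for x y
          using sym by (auto dest: sympD)
        show "successively adj (v # a @ z # rev b)"
          using Cons.prems(5,6) p q q' adjs
          by (auto simp: successively_Cons successively_append_iff hd_append last_rev hd_rev split: if_splits)
        show "adj (last (v # a @ z # rev b)) (hd (v # a @ z # rev b))"
          using Cons.prems(5,6) p q q' adjs
          by (cases b) (auto simp: successively_Cons successively_append_iff)
      qed
      then show ?thesis using acyc by blast
    qed
  qed
qed

text \<open>
  A list \<open>xs\<close> of naturals is an address: read from its end, it says which child to choose at each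
  step away from \<open>r\<close>. The result is the whole path back to \<open>r\<close>, not only its endpoint, because the
  children of a vertex are those neighbours that are not already on the path. The path is then
  simple by construction.
\<close>

primrec root_path :: "('v \<Rightarrow> 'v \<Rightarrow> bool) \<Rightarrow> 'v \<Rightarrow> nat list \<Rightarrow> 'v list" where
  "root_path adj r [] = [r]"
| "root_path adj r (n # xs) =
     from_nat_into ({w. adj (hd (root_path adj r xs)) w} - set (root_path adj r xs)) n
       # root_path adj r xs"

definition tree_chart :: "('v \<Rightarrow> 'v \<Rightarrow> bool) \<Rightarrow> 'v \<Rightarrow> (nat list \<Rightarrow> 'v) \<Rightarrow> bool" where
  "tree_chart adj r \<phi> \<longleftrightarrow> bij \<phi> \<and> \<phi> [] = r \<and>
     (\<forall>xs ys. adj (\<phi> xs) (\<phi> ys) \<longleftrightarrow> (\<exists>n. ys = n # xs) \<or> (\<exists>n. xs = n # ys))"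

text \<open>
  Injectivity is uniqueness of paths. Surjectivity follows by connectedness: a neighbour of a
  reached vertex is either one of its children or already lies on the path to \<open>r\<close>, and every vertex
  of that path has an address as well.
\<close>

lemma tree_chart_exists:
  assumes "aleph0_regular_tree adj"
  shows "\<exists>\<phi>. tree_chart adj r \<phi>"
proof -
  note T = assms[unfolded aleph0_regular_tree_def graph_tree_def simple_graph_def]
  have sym: "adj u v \<longleftrightarrow> adj v u" and irr: "\<not> adj u u" for u v
    using T by (auto dest: sympD irreflpD)
  define P where "P = root_path adj r"
  define C where "C xs = {w. adj (hd (P xs)) w} - set (P xs)" for xs
  define \<phi> where "\<phi> xs = hd (P xs)" for xs
  have P_simps: "P [] = [r]" "P (n # xs) = from_nat_into (C xs) n # P xs" for n xs
    by (simp_all add: P_def C_def)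
  have C: "infinite (C xs)" "countable (C xs)" for xs
    using T by (auto simp: C_def intro: countable_subset)
  have child: "bij_betw (from_nat_into (C xs)) UNIV (C xs)" for xs
    using C by (intro bij_betw_from_nat_into) auto
  have child_in: "from_nat_into (C xs) n \<in> C xs" for xs n
    using child bij_betw_apply by fastforce
  have path: "P xs \<noteq> [] \<and> distinct (P xs) \<and> successively adj (P xs) \<and> last (P xs) = r" for xs
    using child_in sym by (induction xs) (auto simp: P_simps successively_Cons C_def)
  have len: "length (P xs) = Suc (length xs)" for xs
    by (induction xs) (auto simp: P_simps)
  have P_inj: "P xs = P ys \<Longrightarrow> xs = ys" for xs ys
  proof (induction xs arbitrary: ys)
    case Nil
    then show ?case using len[of ys] by (cases ys) (auto simp: P_simps)
  next
    case (Cons n xs)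
    then obtain m zs where ys: "ys = m # zs"
      using len[of ys] len[of "n # xs"] by (cases ys) auto
    with Cons have "xs = zs" by (auto simp: P_simps)
    with Cons.prems ys show ?case
      using child[of zs] by (auto simp: P_simps bij_betw_def dest: injD)
  qed
  have inj: "xs = ys" if "\<phi> xs = \<phi> ys" for xs ys
    using acyclic_unique_path[of adj "P xs" "P ys"] path that T P_inj unfolding \<phi>_def by metis
  have on_path: "\<exists>ys. \<phi> ys = w \<and> (ys = xs \<or> length ys < length xs)" if "w \<in> set (P xs)" for w xs
    using that
  proof (induction xs)
    case Nil
    then show ?case by (auto simp: \<phi>_def P_simps)
  next
    case (Cons n xs)
    show ?case
    proof (cases "w \<in> set (P xs)")
      case True
      then show ?thesis using Cons.IH by fastforce
    next
      case False
      then have "\<phi> (n # xs) = w" using Cons.prems by (auto simp: \<phi>_def P_simps)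
      then show ?thesis by blast
    qed
  qed
  have off_path: "\<exists>n. w = \<phi> (n # xs)" if "adj (\<phi> xs) w" "w \<notin> set (P xs)" for w xs
  proof -
    have "w \<in> C xs" using that by (auto simp: C_def \<phi>_def)
    then show ?thesis using child[of xs] by (auto simp: \<phi>_def P_simps bij_betw_def)
  qed
  have "\<exists>xs. \<phi> xs = v" for v
  proof -
    have "adj\<^sup>*\<^sup>* r v" using T by (auto simp: connected_graph_def)
    then show ?thesis
    proof induction
      case base
      show ?case by (rule exI[of _ "[]"]) (simp add: \<phi>_def P_simps)
    next
      case (step u w)
      then show ?case using on_path off_path by metis
    qed
  qed
  then have "bij \<phi>" using inj by (metis bijI')
  moreover have "\<phi> [] = r" by (simp add: \<phi>_def P_simps)
  moreover have "adj (\<phi> xs) (\<phi> ys) \<longleftrightarrow> (\<exists>n. ys = n # xs) \<or> (\<exists>n. xs = n # ys)" for xs ys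
  proof
    \<comment> \<open>Two adjacent vertices cannot each lie on the path of the other: the vertices of a path
      other than its endpoint have shorter addresses than the endpoint.\<close>
    assume *: "adj (\<phi> xs) (\<phi> ys)"
    then have "\<phi> ys \<notin> set (P xs) \<or> \<phi> xs \<notin> set (P ys)"
      using on_path inj irr by (metis order.asym)
    then show "(\<exists>n. ys = n # xs) \<or> (\<exists>n. xs = n # ys)"
      using off_path * sym inj by metis
  next
    have "adj (\<phi> xs) (\<phi> (n # xs))" for n xs
      using child_in[of xs n] by (auto simp: \<phi>_def P_simps C_def)
    then show "(\<exists>n. ys = n # xs) \<or> (\<exists>n. xs = n # ys) \<Longrightarrow> adj (\<phi> xs) (\<phi> ys)"
      using sym by blast
  qed
  ultimately show ?thesis unfolding tree_chart_def by blast
qed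

lemma graph_AutI_coordinates:
  assumes "bij \<phi>" "bij \<psi>" "\<And>xs ys. adj (\<psi> xs) (\<psi> ys) \<longleftrightarrow> adj (\<phi> xs) (\<phi> ys)"
  shows "\<psi> \<circ> inv \<phi> \<in> graph_Aut adj"
  using assms by (auto simp: graph_Aut_def bij_imp_bij_inv bij_is_surj surj_f_inv_f intro!: bij_comp)

lemma tree_vertex_transitive:
  assumes "aleph0_regular_tree adj"
  obtains g where "g \<in> graph_Aut adj" "g r = s"
proof -
  obtain \<phi> where "tree_chart adj r \<phi>"
    using tree_chart_exists[OF assms] by blast
  then have \<phi>: "bij \<phi>" "\<phi> [] = r"
    "\<And>xs ys. adj (\<phi> xs) (\<phi> ys) \<longleftrightarrow> (\<exists>n. ys = n # xs) \<or> (\<exists>n. xs = n # ys)"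
    by (simp_all add: tree_chart_def)
  obtain \<psi> where "tree_chart adj s \<psi>"
    using tree_chart_exists[OF assms] by blast
  then have \<psi>: "bij \<psi>" "\<psi> [] = s"
    "\<And>xs ys. adj (\<psi> xs) (\<psi> ys) \<longleftrightarrow> (\<exists>n. ys = n # xs) \<or> (\<exists>n. xs = n # ys)"
    by (simp_all add: tree_chart_def)
  have "(\<psi> \<circ> inv \<phi>) r = s"
    using \<phi>(1,2) \<psi>(2) by (metis bij_inv_eq_iff comp_apply)
  moreover have "\<psi> \<circ> inv \<phi> \<in> graph_Aut adj"
    by (rule graph_AutI_coordinates[OF \<phi>(1) \<psi>(1)]) (simp only: \<phi>(3) \<psi>(3))
  ultimately show thesis
    using that by blast
qed

text \<open>
  The vertices other than \<open>r\<close> fall into the branches at \<open>r\<close>, one for each neighbour of \<open>r\<close>, and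
  \<open>\<beta> v\<close> is the number of the branch containing \<open>v\<close>. Only the symmetry of this
  numbering is recorded: any permutation of the branches extends to an automorphism that does
  not disturb the branches left in place. The value \<open>\<beta> r\<close> is arbitrary.
\<close>

definition branch_index :: "('v \<Rightarrow> 'v \<Rightarrow> bool) \<Rightarrow> 'v \<Rightarrow> ('v \<Rightarrow> nat) \<Rightarrow> bool" where
  "branch_index adj r \<beta> \<longleftrightarrow>
     (\<forall>\<sigma>. bij \<sigma> \<longrightarrow> (\<exists>g\<in>graph_Aut adj. g r = r \<and>
        (\<forall>v. v \<noteq> r \<longrightarrow> \<beta> (g v) = \<sigma> (\<beta> v)) \<and>
        (\<forall>v. \<sigma> (\<beta> v) = \<beta> v \<longrightarrow> g v = v)))"

text \<open>The last entry of an address is the first step away from the root, hence names the branch.\<close>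

definition permute_branches :: "(nat \<Rightarrow> nat) \<Rightarrow> nat list \<Rightarrow> nat list" where
  "permute_branches \<sigma> xs = (if xs = [] then [] else butlast xs @ [\<sigma> (last xs)])"

lemma permute_branches_comp:
  "permute_branches \<sigma> (permute_branches \<tau> xs) = permute_branches (\<sigma> \<circ> \<tau>) xs"
  by (auto simp: permute_branches_def)

lemma permute_branches_id: "permute_branches id xs = xs"
  by (auto simp: permute_branches_def)

lemma bij_permute_branches:
  assumes "bij \<sigma>"
  shows "bij (permute_branches \<sigma>)"
proof (rule o_bij[of "permute_branches (inv \<sigma>)"])
  show "permute_branches (inv \<sigma>) \<circ> permute_branches \<sigma> = id"
    "permute_branches \<sigma> \<circ> permute_branches (inv \<sigma>) = id"
    using assms
    by (simp_all add: fun_eq_iff permute_branches_comp permute_branches_id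
        surj_iff[THEN iffD1, OF bij_is_surj] inj_iff[THEN iffD1, OF bij_is_inj])
qed

lemma permute_branches_child:
  assumes "bij \<sigma>"
  shows "(\<exists>n. permute_branches \<sigma> ys = n # permute_branches \<sigma> xs) \<longleftrightarrow> (\<exists>n. ys = n # xs)"
proof -
  have fwd: "\<exists>n. permute_branches \<tau> ys = n # permute_branches \<tau> xs"
    if "ys = m # xs" for m \<tau> xs ys
    using that by (cases "xs = []") (auto simp: permute_branches_def)
  show ?thesis
  proof
    assume "\<exists>n. permute_branches \<sigma> ys = n # permute_branches \<sigma> xs"
    then have "\<exists>n. permute_branches (inv \<sigma> \<circ> \<sigma>) ys = n # permute_branches (inv \<sigma> \<circ> \<sigma>) xs"
      using fwd[where \<tau> = "inv \<sigma>"] unfolding permute_branches_comp[symmetric] by blast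
    then show "\<exists>n. ys = n # xs"
      using assms by (simp add: bij_is_inj permute_branches_id)
  qed (use fwd in blast)
qed

lemma branch_index_exists:
  assumes "aleph0_regular_tree adj"
  obtains \<beta> where "branch_index adj r \<beta>"
proof -
  obtain \<phi> where "tree_chart adj r \<phi>"
    using tree_chart_exists[OF assms] by blast
  then have \<phi>: "bij \<phi>" "\<phi> [] = r"
    "\<And>xs ys. adj (\<phi> xs) (\<phi> ys) \<longleftrightarrow> (\<exists>n. ys = n # xs) \<or> (\<exists>n. xs = n # ys)"
    by (simp_all add: tree_chart_def)
  define \<beta> where "\<beta> v = last (inv \<phi> v)" for v
  have inv: "inv \<phi> (\<phi> xs) = xs" for xs
    using \<phi>(1) by (simp add: bij_is_inj)
  have "branch_index adj r \<beta>"
    unfolding branch_index_def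
  proof (intro allI impI)
    fix \<sigma> :: "nat \<Rightarrow> nat" assume \<sigma>: "bij \<sigma>"
    define g where "g = (\<phi> \<circ> permute_branches \<sigma>) \<circ> inv \<phi>"
    have "g \<in> graph_Aut adj"
      unfolding g_def
      by (intro graph_AutI_coordinates \<phi> bij_comp bij_permute_branches \<sigma>)
        (simp add: \<phi>(3) permute_branches_child[OF \<sigma>])
    moreover have g: "g (\<phi> xs) = \<phi> (permute_branches \<sigma> xs)" for xs
      by (simp add: g_def inv)
    have "g r = r"
      using g[of "[]"] \<phi>(2) by (simp add: permute_branches_def)
    moreover have "\<beta> (g v) = \<sigma> (\<beta> v)" if "v \<noteq> r" for v
    proof -
      obtain xs where "v = \<phi> xs" using \<phi>(1) by (metis bij_pointE)
      with that \<phi>(2) show ?thesis by (auto simp: \<beta>_def g inv permute_branches_def)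
    qed
    moreover have "g v = v" if "\<sigma> (\<beta> v) = \<beta> v" for v
    proof -
      obtain xs where "v = \<phi> xs" using \<phi>(1) by (metis bij_pointE)
      with that show ?thesis by (auto simp: \<beta>_def g inv permute_branches_def)
    qed
    ultimately show "\<exists>g\<in>graph_Aut adj. g r = r \<and>
        (\<forall>v. v \<noteq> r \<longrightarrow> \<beta> (g v) = \<sigma> (\<beta> v)) \<and> (\<forall>v. \<sigma> (\<beta> v) = \<beta> v \<longrightarrow> g v = v)"
      by blast
  qed
  then show thesis by (rule that)
qed

section \<open>Square-summable functions\<close>

text \<open>
  The squared norm of \<open>x\<close> is at most \<open>K\<close>. Phrased by finite sums, this includes membership in
  \<open>ell2\<close> and passes to pointwise limits.
\<close>

definition sq_bounded :: "('v \<Rightarrow> complex) \<Rightarrow> real \<Rightarrow> bool" where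
  "sq_bounded x K \<longleftrightarrow> (\<forall>F. finite F \<longrightarrow> (\<Sum>v\<in>F. (cmod (x v))\<^sup>2) \<le> K)"

lemma ell2_iff_sq_bounded: "x \<in> ell2 \<longleftrightarrow> (\<exists>K. sq_bounded x K)"
proof
  assume "x \<in> ell2"
  then have "sq_bounded x (\<Sum>\<^sub>\<infinity>v. (cmod (x v))\<^sup>2)"
    by (auto simp: sq_bounded_def ell2_def intro: finite_sum_le_infsum)
  then show "\<exists>K. sq_bounded x K" ..
next
  assume "\<exists>K. sq_bounded x K"
  then obtain K where "sq_bounded x K" ..
  then show "x \<in> ell2"
    unfolding ell2_def mem_Collect_eq
    by (intro nonneg_bdd_above_summable_on bdd_aboveI[of _ K]) (auto simp: sq_bounded_def)
qed

lemma sq_bounded_nonneg: "sq_bounded x K \<Longrightarrow> 0 \<le> K"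
  unfolding sq_bounded_def by (metis finite.emptyI sum.empty)

lemma sq_bounded_cmod_le:
  assumes "sq_bounded x (b\<^sup>2)" "0 \<le> b"
  shows "cmod (x v) \<le> b"
  using assms by (auto simp: sq_bounded_def dest!: spec[of _ "{v}"] intro: power2_le_imp_le)

lemma sq_bounded_lam:
  assumes "bij g" "sq_bounded x K"
  shows "sq_bounded (lam g x) K"
  unfolding sq_bounded_def
proof (intro allI impI)
  fix F :: "'a set" assume F: "finite F"
  have "(\<Sum>v\<in>F. (cmod (lam g x v))\<^sup>2) = (\<Sum>v\<in>inv g ` F. (cmod (x v))\<^sup>2)"
    using bij_imp_bij_inv[OF assms(1)]
    by (subst sum.reindex) (auto simp: lam_def bij_def inj_on_def)
  also have "\<dots> \<le> K"
    using assms(2) F by (simp add: sq_bounded_def)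
  finally show "(\<Sum>v\<in>F. (cmod (lam g x v))\<^sup>2) \<le> K" .
qed

text \<open>
  This is the form of completeness that the construction of vectors below requires: a series with
  summable norms converges pointwise to a vector of \<open>ell2\<close>. On each finite set of vertices the
  triangle inequality bounds the partial sums, and the bound survives the limit.
\<close>

lemma ell2_suminf:
  fixes f :: "nat \<Rightarrow> 'v \<Rightarrow> complex"
  assumes f: "\<And>n. sq_bounded (f n) ((b n)\<^sup>2)" and b: "\<And>n. 0 \<le> b n" "summable b"
  shows "summable (\<lambda>n. f n v)" and "(\<lambda>v. \<Sum>n. f n v) \<in> ell2"
proof -
  show sm: "summable (\<lambda>n. f n v)" for v
    by (rule summable_comparison_test'[OF b(2)]) (rule sq_bounded_cmod_le[OF f b(1)])
  have "sq_bounded (\<lambda>v. \<Sum>n. f n v) ((suminf b)\<^sup>2)"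
    unfolding sq_bounded_def
  proof (intro allI impI)
    fix F :: "'v set" assume F: "finite F"
    have part: "L2_set (\<lambda>v. cmod (\<Sum>n<N. f n v)) F \<le> (\<Sum>n<N. b n)" for N
    proof (induction N)
      case 0
      then show ?case by (simp add: L2_set_def)
    next
      case (Suc N)
      have "L2_set (\<lambda>v. cmod (\<Sum>n<Suc N. f n v)) F
          \<le> L2_set (\<lambda>v. cmod (\<Sum>n<N. f n v) + cmod (f N v)) F"
        by (rule L2_set_mono) (auto intro: norm_triangle_ineq)
      also have "\<dots> \<le> L2_set (\<lambda>v. cmod (\<Sum>n<N. f n v)) F + L2_set (\<lambda>v. cmod (f N v)) F"
        by (rule L2_set_triangle_ineq)
      also have "L2_set (\<lambda>v. cmod (f N v)) F \<le> b N"
        unfolding L2_set_def using f[of N] F b(1) by (intro real_le_lsqrt) (auto simp: sq_bounded_def)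
      finally show ?case using Suc by simp
    qed
    have "(\<Sum>v\<in>F. (cmod (\<Sum>n<N. f n v))\<^sup>2) \<le> (suminf b)\<^sup>2" for N
    proof -
      have "sqrt (\<Sum>v\<in>F. (cmod (\<Sum>n<N. f n v))\<^sup>2) \<le> suminf b"
        using part[of N] sum_le_suminf[OF b(2), of "{..<N}"] b(1) by (simp add: L2_set_def)
      then show ?thesis
        by (rule sqrt_le_D)
    qed
    moreover have "(\<lambda>N. \<Sum>v\<in>F. (cmod (\<Sum>n<N. f n v))\<^sup>2)
        \<longlonglongrightarrow> (\<Sum>v\<in>F. (cmod (\<Sum>n. f n v))\<^sup>2)"
      by (intro tendsto_intros summable_LIMSEQ sm)
    ultimately show "(\<Sum>v\<in>F. (cmod (\<Sum>n. f n v))\<^sup>2) \<le> (suminf b)\<^sup>2"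
      by (intro LIMSEQ_le_const2) auto
  qed
  then show "(\<lambda>v. \<Sum>n. f n v) \<in> ell2"
    by (auto simp: ell2_iff_sq_bounded)
qed

text \<open>
  On functions supported in \<open>S\<close>, the average \<open>T\<close> of the two translations halves the squared norm,
  because it produces two half-sized copies with disjoint supports. So \<open>1 - T\<close> is invertible there
  by the Neumann series, and \<open>f = h - T h\<close> presents \<open>f\<close> as a combination of differences \<open>h - lam g h\<close>.
\<close>

lemma averaging_resolvent:
  fixes g\<^sub>1 g\<^sub>2 :: "'v \<Rightarrow> 'v"
  assumes bij: "bij g\<^sub>1" "bij g\<^sub>2" and into: "g\<^sub>1 ` S \<subseteq> S" "g\<^sub>2 ` S \<subseteq> S" and disj: "g\<^sub>1 ` S \<inter> g\<^sub>2 ` S = {}"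
    and f: "f \<in> ell2" "\<And>v. v \<notin> S \<Longrightarrow> f v = 0"
  obtains h where "h \<in> ell2" "f = (\<lambda>v. h v + (- 1 / 2) * (lam g\<^sub>1 h v + lam g\<^sub>2 h v))"
proof -
  define T where "T x = (\<lambda>v. (lam g\<^sub>1 x v + lam g\<^sub>2 x v) / 2)" for x :: "'v \<Rightarrow> complex"
  have inv: "g (inv g v) = v" if "bij g" for g :: "'v \<Rightarrow> 'v" and v
    using that by (simp add: bij_is_surj surj_f_inv_f)
  have T_supp: "T x v = 0" if "\<And>v. v \<notin> S \<Longrightarrow> x v = 0" "v \<notin> S" for x v
  proof -
    have "inv g\<^sub>1 v \<notin> S" "inv g\<^sub>2 v \<notin> S"
      using that(2) into inv[OF bij(1), of v] inv[OF bij(2), of v] by force+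
    then show ?thesis using that by (simp add: T_def lam_def)
  qed
  have T_half: "sq_bounded (T x) (K / 2)" if x: "\<And>v. v \<notin> S \<Longrightarrow> x v = 0" "sq_bounded x K" for x K
    unfolding sq_bounded_def
  proof (intro allI impI)
    fix F :: "'v set" assume F: "finite F"
    have "(cmod (T x v))\<^sup>2 = ((cmod (lam g\<^sub>1 x v))\<^sup>2 + (cmod (lam g\<^sub>2 x v))\<^sup>2) / 4" for v
    proof -
      have "inv g\<^sub>1 v \<notin> S \<or> inv g\<^sub>2 v \<notin> S"
        using disj inv[OF bij(1), of v] inv[OF bij(2), of v] by force
      then have "lam g\<^sub>1 x v = 0 \<or> lam g\<^sub>2 x v = 0"
        using x(1) by (auto simp: lam_def)
      then show ?thesis
        by (auto simp: T_def norm_divide power_divide)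
    qed
    then have "(\<Sum>v\<in>F. (cmod (T x v))\<^sup>2)
        = ((\<Sum>v\<in>F. (cmod (lam g\<^sub>1 x v))\<^sup>2) + (\<Sum>v\<in>F. (cmod (lam g\<^sub>2 x v))\<^sup>2)) / 4"
      by (simp only: sum.distrib flip: sum_divide_distrib)
    also have "\<dots> \<le> (K + K) / 4"
      using sq_bounded_lam[OF bij(1) x(2)] sq_bounded_lam[OF bij(2) x(2)] F
      by (intro divide_right_mono add_mono) (auto simp: sq_bounded_def)
    finally show "(\<Sum>v\<in>F. (cmod (T x v))\<^sup>2) \<le> K / 2" by simp
  qed
  obtain K where K: "sq_bounded f K"
    using f(1) ell2_iff_sq_bounded by blast
  have "0 \<le> K" using K by (rule sq_bounded_nonneg)
  define b where "b n = sqrt K * (sqrt (1 / 2)) ^ n" for n :: nat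
  have b_sq: "(b n)\<^sup>2 = K / 2 ^ n" for n
  proof -
    have "((sqrt (1 / 2)) ^ n)\<^sup>2 = ((sqrt (1 / 2))\<^sup>2) ^ n"
      by (metis mult.commute power_mult)
    then show ?thesis
      using \<open>0 \<le> K\<close> by (simp add: b_def power_mult_distrib power_divide)
  qed
  have iter: "(\<forall>v. v \<notin> S \<longrightarrow> (T ^^ n) f v = 0) \<and> sq_bounded ((T ^^ n) f) (K / 2 ^ n)" for n
  proof (induction n)
    case 0
    then show ?case using f K by simp
  next
    case (Suc n)
    then show ?case
      using T_supp[of "(T ^^ n) f"] T_half[of "(T ^^ n) f" "K / 2 ^ n"] by (auto simp: mult.commute)
  qed
  have "summable b"
    unfolding b_def by (intro summable_mult summable_geometric) (simp add: real_sqrt_divide)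
  moreover have "sq_bounded ((T ^^ n) f) ((b n)\<^sup>2)" "0 \<le> b n" for n
    using iter[of n] \<open>0 \<le> K\<close> by (simp_all add: b_sq) (simp add: b_def)
  ultimately have sm: "summable (\<lambda>n. (T ^^ n) f v)" and ell2: "(\<lambda>v. \<Sum>n. (T ^^ n) f v) \<in> ell2" for v
    using ell2_suminf[of "\<lambda>n. (T ^^ n) f" b] by blast+
  define h where "h v = (\<Sum>n. (T ^^ n) f v)" for v
  have "h v = f v + (lam g\<^sub>1 h v + lam g\<^sub>2 h v) / 2" for v
  proof -
    have "h v = f v + (\<Sum>n. (T ^^ Suc n) f v)"
      using suminf_split_head[OF sm[of v]] by (simp add: h_def)
    also have "(\<Sum>n. (T ^^ Suc n) f v)
        = (\<Sum>n. ((T ^^ n) f (inv g\<^sub>1 v) + (T ^^ n) f (inv g\<^sub>2 v)) / 2)"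
      by (simp add: T_def lam_def)
    also have "\<dots> = (lam g\<^sub>1 h v + lam g\<^sub>2 h v) / 2"
      by (simp add: lam_def h_def suminf_divide suminf_add sm summable_add)
    finally show ?thesis .
  qed
  then have "f v = h v - (lam g\<^sub>1 h v + lam g\<^sub>2 h v) / 2" for v
    by (metis add_diff_cancel_right')
  then have f_eq: "f v = h v + (- 1 / 2) * (lam g\<^sub>1 h v + lam g\<^sub>2 h v)" for v
    by simp
  have "h \<in> ell2"
    unfolding h_def by (rule ell2)
  then show thesis
    by (rule that) (rule ext, rule f_eq)
qed

section \<open>Functionals invariant under permutations of branches\<close>

lemma exists_bij_extending:
  fixes A A' B :: "nat set"
  assumes "A \<subseteq> B" "A' \<subseteq> B" and inf: "infinite A" "infinite A'" "infinite (B - A)" "infinite (B - A')"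
  obtains \<sigma> where "bij \<sigma>" "\<sigma> ` A = A'" "\<And>i. i \<notin> B \<Longrightarrow> \<sigma> i = i"
proof -
  have "\<exists>f. bij_betw f X Y" if "infinite X" "infinite Y" for X Y :: "nat set"
    using bij_betw_trans[OF to_nat_on_infinite[of X] bij_betw_from_nat_into[of Y]] that
    by (intro exI) auto
  then obtain f h where f: "bij_betw f A A'" and h: "bij_betw h (B - A) (B - A')"
    using inf by meson
  define \<sigma> where "\<sigma> i = (if i \<in> A then f i else if i \<in> B then h i else i)" for i
  have A: "bij_betw \<sigma> A A'"
    using f by (rule bij_betw_cong[THEN iffD1, rotated]) (simp add: \<sigma>_def)
  have "bij_betw \<sigma> (B - A) (B - A')"
    using h by (rule bij_betw_cong[THEN iffD1, rotated]) (simp add: \<sigma>_def)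
  with A have "bij_betw \<sigma> (A \<union> (B - A)) (A' \<union> (B - A'))"
    by (rule bij_betw_combine) auto
  moreover have "bij_betw \<sigma> (- B) (- B)"
    by (rule bij_betw_cong[THEN iffD1, rotated], rule bij_betw_id) (use assms in \<open>auto simp: \<sigma>_def\<close>)
  ultimately have "bij_betw \<sigma> (A \<union> (B - A) \<union> - B) (A' \<union> (B - A') \<union> - B)"
    by (rule bij_betw_combine) (use assms in auto)
  moreover have "A \<union> (B - A) \<union> - B = UNIV" "A' \<union> (B - A') \<union> - B = UNIV"
    using assms by auto
  ultimately have "bij \<sigma>" by simp
  moreover have "\<sigma> ` A = A'" using A by (simp add: bij_betw_def)
  moreover have "\<sigma> i = i" if "i \<notin> B" for i using that assms by (auto simp: \<sigma>_def)
  ultimately show thesis by (rule that)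
qed

lemma infinite_split:
  assumes "infinite (B :: nat set)"
  obtains A where "A \<subseteq> B" "infinite A" "infinite (B - A)"
proof -
  obtain C :: "nat \<Rightarrow> nat set" where C: "pairwise (\<lambda>i j. disjnt (C i) (C j)) UNIV"
    "(\<Union>i. C i) \<subseteq> B" "\<And>i. infinite (C i)"
    using infinite_infinite_partition[OF assms] by metis
  have "C 1 \<subseteq> B - C 0"
    using C(2) pairwiseD[OF C(1), of 0 1] by (auto simp: disjnt_iff)
  then show thesis
    using that[of "C 0"] C infinite_super by blast
qed

definition branches :: "'v \<Rightarrow> ('v \<Rightarrow> nat) \<Rightarrow> nat set \<Rightarrow> 'v set" where
  "branches r \<beta> A = {v. v \<noteq> r \<and> \<beta> v \<in> A}"

lemma permuting_automorphism:
  assumes "branch_index adj r \<beta>" "bij \<sigma>"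
  shows "\<exists>g\<in>graph_Aut adj. bij g \<and> g r = r \<and>
    (\<forall>A. g ` branches r \<beta> A = branches r \<beta> (\<sigma> ` A)) \<and> (\<forall>v. \<sigma> (\<beta> v) = \<beta> v \<longrightarrow> g v = v)"
proof -
  obtain g where g: "g \<in> graph_Aut adj" "g r = r" "\<And>v. v \<noteq> r \<Longrightarrow> \<beta> (g v) = \<sigma> (\<beta> v)"
    "\<And>v. \<sigma> (\<beta> v) = \<beta> v \<Longrightarrow> g v = v"
    using assms unfolding branch_index_def by blast
  have bij: "bij g" using g(1) by (simp add: graph_Aut_def)
  have inj: "g v = r \<longleftrightarrow> v = r" for v
    using bij_is_inj[OF bij] g(2) by (metis injD)
  have "g ` branches r \<beta> A = branches r \<beta> (\<sigma> ` A)" for A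
  proof
    show "g ` branches r \<beta> A \<subseteq> branches r \<beta> (\<sigma> ` A)"
      using g(3) inj by (auto simp: branches_def)
    show "branches r \<beta> (\<sigma> ` A) \<subseteq> g ` branches r \<beta> A"
    proof
      fix w assume w: "w \<in> branches r \<beta> (\<sigma> ` A)"
      obtain v where v: "w = g v" using surjD[OF bij_is_surj[OF bij]] by blast
      have "v \<in> branches r \<beta> A"
      proof -
        have "v \<noteq> r" using w v inj[of v] by (simp add: branches_def)
        moreover from this have "\<sigma> (\<beta> v) \<in> \<sigma> ` A"
          using w v g(3)[of v] by (simp add: branches_def)
        ultimately show ?thesis
          using bij_is_inj[OF assms(2)] by (simp add: branches_def inj_image_mem_iff)
      qed
      then show "w \<in> g ` branches r \<beta> A" using v by blast
    qed
  qed
  then show ?thesis using g(1,2,4) bij by blast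
qed

text \<open>
  Continuity of \<open>L\<close> is not assumed. An infinite, co-infinite part \<open>A\<close> of the branches in \<open>B\<close> can be
  moved into either of two disjoint parts of itself by permutations of \<open>B\<close>. The previous
  decomposition then writes a function supported on \<open>A\<close> as a finite combination of differences
  \<open>h - lam g h\<close>, which \<open>L\<close> kills. A function supported on \<open>B\<close> is a sum of two such functions.
\<close>

lemma invariant_functional_vanishes:
  assumes \<beta>: "branch_index adj r \<beta>"
    and add: "\<And>x y. x \<in> ell2 \<Longrightarrow> y \<in> ell2 \<Longrightarrow> L (\<lambda>v. x v + y v) = L x + L y"
    and scale: "\<And>a x. x \<in> ell2 \<Longrightarrow> L (\<lambda>v. a * x v) = a * (L x :: complex)"
    and invariant: "\<And>g x. g \<in> graph_Aut adj \<Longrightarrow> (\<And>v. v \<notin> branches r \<beta> B \<Longrightarrow> g v = v) \<Longrightarrow> x \<in> ell2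
      \<Longrightarrow> L (lam g x) = L x"
    and B: "infinite B" and f: "f \<in> ell2" "\<And>v. v \<notin> branches r \<beta> B \<Longrightarrow> f v = 0"
  shows "L f = 0"
proof -
  have half: "L e = 0"
    if A: "A \<subseteq> B" "infinite A" "infinite (B - A)" and e: "e \<in> ell2" "\<And>v. v \<notin> branches r \<beta> A \<Longrightarrow> e v = 0"
    for A e
  proof -
    obtain A\<^sub>1 where A\<^sub>1: "A\<^sub>1 \<subseteq> A" "infinite A\<^sub>1" "infinite (A - A\<^sub>1)"
      by (rule infinite_split[OF A(2)])
    define A\<^sub>2 where "A\<^sub>2 = A - A\<^sub>1"
    have "B - A \<subseteq> B - A\<^sub>1" "B - A \<subseteq> B - A\<^sub>2"
      using A\<^sub>1(1) by (auto simp: A\<^sub>2_def)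
    then have inf: "infinite (B - A\<^sub>1)" "infinite (B - A\<^sub>2)"
      using A(3) infinite_super by blast+
    obtain \<sigma>\<^sub>1 where \<sigma>\<^sub>1: "bij \<sigma>\<^sub>1" "\<sigma>\<^sub>1 ` A = A\<^sub>1" "\<And>i. i \<notin> B \<Longrightarrow> \<sigma>\<^sub>1 i = i"
      by (rule exists_bij_extending[of A B A\<^sub>1]) (use A A\<^sub>1 inf in auto)
    obtain \<sigma>\<^sub>2 where \<sigma>\<^sub>2: "bij \<sigma>\<^sub>2" "\<sigma>\<^sub>2 ` A = A\<^sub>2" "\<And>i. i \<notin> B \<Longrightarrow> \<sigma>\<^sub>2 i = i"
      by (rule exists_bij_extending[of A B A\<^sub>2]) (use A A\<^sub>1 inf in \<open>auto simp: A\<^sub>2_def\<close>)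
    obtain g\<^sub>1 where g\<^sub>1: "g\<^sub>1 \<in> graph_Aut adj" "bij g\<^sub>1" "g\<^sub>1 r = r"
      "\<And>A. g\<^sub>1 ` branches r \<beta> A = branches r \<beta> (\<sigma>\<^sub>1 ` A)" "\<And>v. \<sigma>\<^sub>1 (\<beta> v) = \<beta> v \<Longrightarrow> g\<^sub>1 v = v"
      using permuting_automorphism[OF \<beta> \<sigma>\<^sub>1(1)] by blast
    obtain g\<^sub>2 where g\<^sub>2: "g\<^sub>2 \<in> graph_Aut adj" "bij g\<^sub>2" "g\<^sub>2 r = r"
      "\<And>A. g\<^sub>2 ` branches r \<beta> A = branches r \<beta> (\<sigma>\<^sub>2 ` A)" "\<And>v. \<sigma>\<^sub>2 (\<beta> v) = \<beta> v \<Longrightarrow> g\<^sub>2 v = v"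
      using permuting_automorphism[OF \<beta> \<sigma>\<^sub>2(1)] by blast
    obtain h where h: "h \<in> ell2" and e_eq: "e = (\<lambda>v. h v + (- 1 / 2) * (lam g\<^sub>1 h v + lam g\<^sub>2 h v))"
    proof (rule averaging_resolvent[OF g\<^sub>1(2) g\<^sub>2(2) _ _ _ e])
      show "g\<^sub>1 ` branches r \<beta> A \<subseteq> branches r \<beta> A" "g\<^sub>2 ` branches r \<beta> A \<subseteq> branches r \<beta> A"
        "g\<^sub>1 ` branches r \<beta> A \<inter> g\<^sub>2 ` branches r \<beta> A = {}"
        using A\<^sub>1(1) unfolding g\<^sub>1(4) g\<^sub>2(4) \<sigma>\<^sub>1(2) \<sigma>\<^sub>2(2) by (auto simp: branches_def A\<^sub>2_def)
    qed
    have "g\<^sub>1 v = v" "g\<^sub>2 v = v" if "v \<notin> branches r \<beta> B" for v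
      using that g\<^sub>1(3,5) g\<^sub>2(3,5) \<sigma>\<^sub>1(3) \<sigma>\<^sub>2(3) by (auto simp: branches_def)
    then have "L (lam g\<^sub>1 h) = L h" "L (lam g\<^sub>2 h) = L h"
      using invariant g\<^sub>1(1) g\<^sub>2(1) h by blast+
    moreover have "lam g\<^sub>1 h \<in> ell2" "lam g\<^sub>2 h \<in> ell2"
      using lam_ell2 g\<^sub>1(2) g\<^sub>2(2) h by blast+
    moreover have "(\<lambda>v. lam g\<^sub>1 h v + lam g\<^sub>2 h v) \<in> ell2"
      using calculation by (intro ell2_add)
    ultimately have "L e = L h + (- 1 / 2) * (L h + L h)"
      unfolding e_eq by (simp only: add scale ell2_scale h)
    then show "L e = 0" by simp
  qed
  obtain A where A: "A \<subseteq> B" "infinite A" "infinite (B - A)"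
    by (rule infinite_split[OF B])
  define e where "e C v = (if v \<in> branches r \<beta> C then f v else 0)" for C v
  have e: "e C \<in> ell2" for C
    using f(1) unfolding ell2_def mem_Collect_eq
    by (rule summable_on_comparison_test) (auto simp: e_def)
  have "L (e A) = 0" by (rule half[OF A e]) (simp add: e_def)
  moreover have "B - (B - A) = A" using A by blast
  then have "L (e (B - A)) = 0" by (intro half[of "B - A"] e) (use A in \<open>auto simp: e_def\<close>)
  moreover have "f = (\<lambda>v. e A v + e (B - A) v)"
    using f(2) A(1) by (auto simp: fun_eq_iff e_def branches_def)
  ultimately show ?thesis
    using add[OF e e, of A "B - A"] by simp
qed

section \<open>Invariant inner products\<close>

definition cutoff :: "'v set \<Rightarrow> ('v \<Rightarrow> complex) \<Rightarrow> 'v \<Rightarrow> complex" where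
  "cutoff S x = (\<lambda>v. if v \<in> S then x v else 0)"

lemma cutoff_ell2: "x \<in> ell2 \<Longrightarrow> cutoff S x \<in> ell2"
  unfolding ell2_def mem_Collect_eq
  by (rule summable_on_comparison_test) (auto simp: cutoff_def)

lemma ell2_tail:
  assumes "x \<in> ell2" "0 < \<epsilon>"
  shows "\<exists>F. finite F \<and> sq_bounded (cutoff (- F) x) \<epsilon>"
proof -
  let ?s = "\<lambda>v. (cmod (x v))\<^sup>2"
  have sm: "?s summable_on UNIV" using assms(1) by (simp add: ell2_def)
  obtain F where F: "finite F" "dist (sum ?s F) (infsum ?s UNIV) \<le> \<epsilon>"
    using infsum_finite_approximation[OF sm assms(2)] by blast
  have "sq_bounded (cutoff (- F) x) \<epsilon>"
    unfolding sq_bounded_def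
  proof (intro allI impI)
    fix E :: "'a set" assume E: "finite E"
    have "(\<Sum>v\<in>E. (cmod (cutoff (- F) x v))\<^sup>2) = sum ?s (E - F)"
      by (rule sum.mono_neutral_cong_right) (use E in \<open>auto simp: cutoff_def\<close>)
    also have "\<dots> = sum ?s (E \<union> F) - sum ?s F"
      using E F(1) sum.subset_diff[of F "E \<union> F" ?s] by (simp add: Un_Diff)
    also have "\<dots> \<le> infsum ?s UNIV - sum ?s F"
      using finite_sum_le_infsum[OF sm, of "E \<union> F"] E F(1) by simp
    also have "\<dots> \<le> \<epsilon>" using F(2) by (simp add: dist_real_def)
    finally show "(\<Sum>v\<in>E. (cmod (cutoff (- F) x v))\<^sup>2) \<le> \<epsilon>" .
  qed
  then show ?thesis using F(1) by blast
qed

lemma sq_bounded_scale: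
  "sq_bounded x K \<Longrightarrow> sq_bounded (\<lambda>v. a * x v) ((cmod a)\<^sup>2 * K)"
  by (auto simp: sq_bounded_def norm_mult power_mult_distrib simp flip: sum_distrib_left
      intro: mult_left_mono)

definition delta :: "'v \<Rightarrow> 'v \<Rightarrow> complex" where
  "delta v = (\<lambda>w. if w = v then 1 else 0)"

lemma delta_ell2: "delta v \<in> ell2"
proof -
  have "sq_bounded (delta v) 1"
    unfolding sq_bounded_def
  proof (intro allI impI)
    fix F :: "'a set" assume F: "finite F"
    have "(\<Sum>w\<in>F. (cmod (delta v w))\<^sup>2) = (\<Sum>w\<in>F. if w = v then 1 else 0)"
      by (rule sum.cong) (auto simp: delta_def)
    also have "\<dots> \<le> 1" using F by simp
    finally show "(\<Sum>w\<in>F. (cmod (delta v w))\<^sup>2) \<le> 1" .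
  qed
  then show ?thesis by (auto simp: ell2_iff_sq_bounded)
qed

lemma lam_delta: "bij g \<Longrightarrow> lam g (delta v) = delta (g v)"
  by (auto simp: lam_def delta_def fun_eq_iff bij_is_inj bij_is_surj surj_f_inv_f)

lemma ell2_inner_self: "x \<in> ell2 \<Longrightarrow> ell2_inner x x = of_real (\<Sum>\<^sub>\<infinity>v. (cmod (x v))\<^sup>2)"
  unfolding ell2_inner_def ell2_def mem_Collect_eq complex_norm_square[symmetric]
  by (intro infsumI has_sum_of_real has_sum_infsum)

lemma inner_product_on_ell2_inner: "inner_product_on ell2 ell2_inner"
  unfolding inner_product_on_def
proof (intro conjI ballI allI impI)
  fix x y z :: "'v \<Rightarrow> complex" assume "x \<in> ell2" "y \<in> ell2" "z \<in> ell2"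
  then show "ell2_inner (\<lambda>v. x v + y v) z = ell2_inner x z + ell2_inner y z"
    unfolding ell2_inner_def
    by (simp add: distrib_right infsum_add ell2_inner_summable)
next
  fix a and x y :: "'v \<Rightarrow> complex" assume "x \<in> ell2" "y \<in> ell2"
  then show "ell2_inner (\<lambda>v. a * x v) y = a * ell2_inner x y"
    unfolding ell2_inner_def
    by (simp add: mult.assoc infsum_cmult_right ell2_inner_summable)
next
  fix x y :: "'v \<Rightarrow> complex" assume "x \<in> ell2" "y \<in> ell2"
  show "ell2_inner y x = cnj (ell2_inner x y)"
    unfolding ell2_inner_def infsum_cnj[symmetric] by (simp add: mult.commute)
next
  fix x :: "'v \<Rightarrow> complex" assume x: "x \<in> ell2" "x \<noteq> (\<lambda>_. 0)"
  then obtain v where "x v \<noteq> 0" by blast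
  then have "0 < (\<Sum>w\<in>{v}. (cmod (x w))\<^sup>2)" by simp
  also have "\<dots> \<le> (\<Sum>\<^sub>\<infinity>v. (cmod (x v))\<^sup>2)"
    by (rule finite_sum_le_infsum) (use x in \<open>auto simp: ell2_def\<close>)
  finally show "0 < Re (ell2_inner x x)"
    using x(1) by (simp add: ell2_inner_self)
qed

lemma lam_Aut_invariant_ell2_inner:
  fixes adj :: "'v \<Rightarrow> 'v \<Rightarrow> bool"
  shows "lam_Aut_invariant adj ell2_inner"
  unfolding lam_Aut_invariant_def
proof (intro ballI)
  fix g and x y :: "'v \<Rightarrow> complex" assume "g \<in> graph_Aut adj"
  then have "bij (inv g)" by (auto simp: graph_Aut_def bij_imp_bij_inv)
  from infsum_reindex_bij_betw[OF this, of "\<lambda>v. x v * cnj (y v)"]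
  show "ell2_inner (lam g x) (lam g y) = ell2_inner x y"
    by (simp add: ell2_inner_def lam_def)
qed

text \<open>
  The locale makes every fact below available both for an arbitrary invariant inner product and for
  the usual one.
\<close>

locale invariant_inner_product =
  fixes adj :: "'v \<Rightarrow> 'v \<Rightarrow> bool" and ip :: "('v \<Rightarrow> complex) \<Rightarrow> ('v \<Rightarrow> complex) \<Rightarrow> complex"
  assumes tree: "aleph0_regular_tree adj"
    and ip: "inner_product_on ell2 ip"
    and inv_ip: "lam_Aut_invariant adj ip"
begin

lemma add_left: "x \<in> ell2 \<Longrightarrow> y \<in> ell2 \<Longrightarrow> z \<in> ell2 \<Longrightarrow> ip (\<lambda>v. x v + y v) z = ip x z + ip y z"
  and scale_left: "x \<in> ell2 \<Longrightarrow> y \<in> ell2 \<Longrightarrow> ip (\<lambda>v. a * x v) y = a * ip x y"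
  and conj_sym: "x \<in> ell2 \<Longrightarrow> y \<in> ell2 \<Longrightarrow> ip y x = cnj (ip x y)"
  and pos: "x \<in> ell2 \<Longrightarrow> x \<noteq> (\<lambda>_. 0) \<Longrightarrow> 0 < Re (ip x x)"
  using ip unfolding inner_product_on_def by blast+

lemma add_right:
  assumes "x \<in> ell2" "y \<in> ell2" "z \<in> ell2"
  shows "ip z (\<lambda>v. x v + y v) = ip z x + ip z y"
  using assms add_left[of x y z] conj_sym[of _ z] ell2_add by (metis complex_cnj_add)

lemma scale_right:
  assumes "x \<in> ell2" "y \<in> ell2"
  shows "ip y (\<lambda>v. a * x v) = cnj a * ip y x"
  using assms scale_left[of x y a] conj_sym[of _ y] ell2_scale by (metis complex_cnj_mult)

lemma invariant: "g \<in> graph_Aut adj \<Longrightarrow> x \<in> ell2 \<Longrightarrow> y \<in> ell2 \<Longrightarrow> ip (lam g x) (lam g y) = ip x y"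
  using inv_ip by (auto simp: lam_Aut_invariant_def)

definition sqnorm :: "('v \<Rightarrow> complex) \<Rightarrow> real" where
  "sqnorm x = Re (ip x x)"

lemma ip_zero_right: "x \<in> ell2 \<Longrightarrow> ip x (\<lambda>_. 0) = 0"
  using scale_right[of "delta undefined" x 0] by (simp add: delta_ell2)

lemma sqnorm_nonneg: "x \<in> ell2 \<Longrightarrow> 0 \<le> sqnorm x"
  using pos[of x] ip_zero_right[of x] by (cases "x = (\<lambda>_. 0)") (auto simp: sqnorm_def)

lemma ip_self: "x \<in> ell2 \<Longrightarrow> ip x x = of_real (sqnorm x)"
  using conj_sym[of x x] by (simp add: sqnorm_def complex_eq_iff)

lemma sqnorm_add:
  assumes "x \<in> ell2" "y \<in> ell2"
  shows "sqnorm (\<lambda>v. x v + y v) = sqnorm x + sqnorm y + 2 * Re (ip x y)"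
  using assms conj_sym[of x y] by (simp add: sqnorm_def add_left add_right ell2_add)

lemma sqnorm_scale:
  assumes "x \<in> ell2"
  shows "sqnorm (\<lambda>v. a * x v) = (cmod a)\<^sup>2 * sqnorm x"
proof -
  have "ip (\<lambda>v. a * x v) (\<lambda>v. a * x v) = (a * cnj a) * ip x x"
    using assms by (simp add: scale_left scale_right ell2_scale)
  also have "\<dots> = of_real ((cmod a)\<^sup>2 * sqnorm x)"
    using assms by (simp only: ip_self of_real_mult complex_norm_square)
  finally show ?thesis by (simp add: sqnorm_def)
qed

lemma sqnorm_lam: "g \<in> graph_Aut adj \<Longrightarrow> x \<in> ell2 \<Longrightarrow> sqnorm (lam g x) = sqnorm x"
  by (simp add: sqnorm_def invariant)

text \<open>The common squared length of the unit vectors, which will be the scalar multiple.\<close>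

definition weight :: real where
  "weight = sqnorm (delta undefined)"

lemma sqnorm_delta: "sqnorm (delta v) = weight"
proof -
  obtain g where g: "g \<in> graph_Aut adj" "g undefined = v"
    using tree_vertex_transitive[OF tree] by blast
  then have "lam g (delta undefined) = delta v"
    by (simp add: lam_delta graph_Aut_def)
  then show ?thesis
    using sqnorm_lam[OF g(1) delta_ell2[of undefined]] by (simp add: weight_def)
qed

lemma weight_pos: "0 < weight"
proof -
  have "delta undefined \<noteq> (\<lambda>_. 0)"
    by (auto simp: delta_def fun_eq_iff)
  then show ?thesis
    unfolding weight_def sqnorm_def by (intro pos delta_ell2)
qed

text \<open>
  For \<open>y\<close> vanishing on the branches in \<open>B\<close>, the functional \<open>\<lambda>x. ip x y\<close> is invariant under
  automorphisms that act only inside these branches, because they fix \<open>y\<close>.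
\<close>

lemma ip_eq_zero:
  assumes \<beta>: "branch_index adj r \<beta>" and B: "infinite B"
    and x: "x \<in> ell2" "\<And>v. v \<notin> branches r \<beta> B \<Longrightarrow> x v = 0"
    and y: "y \<in> ell2" "\<And>v. v \<in> branches r \<beta> B \<Longrightarrow> y v = 0"
  shows "ip x y = 0"
proof (rule invariant_functional_vanishes[OF \<beta>, where L = "\<lambda>x. ip x y" and B = B])
  fix g and x :: "'v \<Rightarrow> complex"
  assume g: "g \<in> graph_Aut adj" "\<And>v. v \<notin> branches r \<beta> B \<Longrightarrow> g v = v" and x: "x \<in> ell2"
  have bij: "bij g" using g(1) by (simp add: graph_Aut_def)
  have "y (inv g v) = y v" for v
  proof (cases "v \<in> branches r \<beta> B")
    case True
    have "inv g v \<in> branches r \<beta> B"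
    proof (rule ccontr)
      assume "inv g v \<notin> branches r \<beta> B"
      then have "g (inv g v) = inv g v" by (rule g(2))
      then show False
        using True \<open>inv g v \<notin> branches r \<beta> B\<close> bij by (simp add: bij_is_surj surj_f_inv_f)
    qed
    then show ?thesis using True y(2) by simp
  next
    case False
    then have "inv g v = v"
      using g(2)[of v] bij by (metis bij_inv_eq_iff)
    then show ?thesis by simp
  qed
  then have "lam g y = y" by (simp add: lam_def)
  then show "ip (lam g x) y = ip x y"
    using invariant[OF g(1) x y(1)] by simp
qed (use B x y in \<open>simp_all add: add_left scale_left\<close>)

text \<open>
  Seen from \<open>v\<close>, the unit vector at \<open>v\<close> vanishes on all branches, so it is orthogonal to every
  function that vanishes at \<open>v\<close>.
\<close>

lemma ip_delta:
  fixes x :: "'v \<Rightarrow> complex"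
  assumes x: "x \<in> ell2"
  shows "ip x (delta v) = weight * x v"
proof -
  obtain \<beta> where \<beta>: "branch_index adj v \<beta>"
    by (rule branch_index_exists[OF tree])
  have "ip (cutoff (- {v}) x) (delta v) = 0"
    by (rule ip_eq_zero[OF \<beta>, of UNIV], simp, simp add: x cutoff_ell2)
      (auto simp: delta_ell2, auto simp: branches_def cutoff_def delta_def)
  moreover have "x = (\<lambda>w. x v * delta v w + cutoff (- {v}) x w)"
    by (auto simp: delta_def cutoff_def fun_eq_iff)
  then have "ip x (delta v) = x v * ip (delta v) (delta v) + ip (cutoff (- {v}) x) (delta v)"
    using add_left[of "\<lambda>w. x v * delta v w" "cutoff (- {v}) x" "delta v"]
    by (simp add: x cutoff_ell2 delta_ell2 ell2_scale scale_left)
  ultimately show ?thesis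
    by (simp add: ip_self delta_ell2 sqnorm_delta)
qed

lemma ip_cutoff_finite:
  assumes "finite F" and x: "x \<in> ell2" and y: "y \<in> ell2"
  shows "ip x (cutoff F y) = weight * (\<Sum>v\<in>F. x v * cnj (y v))"
  using assms(1)
proof (induction F)
  case empty
  then show ?case by (simp add: cutoff_def ip_zero_right x)
next
  case (insert v F)
  have "cutoff (insert v F) y = (\<lambda>w. y v * delta v w + cutoff F y w)"
    using insert.hyps by (auto simp: delta_def cutoff_def fun_eq_iff)
  then have "ip x (cutoff (insert v F) y) = cnj (y v) * ip x (delta v) + ip x (cutoff F y)"
    by (simp add: add_right x y cutoff_ell2 delta_ell2 ell2_scale scale_right)
  then show ?case
    using insert by (simp add: ip_delta x algebra_simps)
qed

lemma sqnorm_split_finite: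
  assumes F: "finite F" and x: "x \<in> ell2"
  shows "sqnorm x = weight * (\<Sum>v\<in>F. (cmod (x v))\<^sup>2) + sqnorm (cutoff (- F) x)"
proof -
  have "x = (\<lambda>v. cutoff (- F) x v + cutoff F x v)"
    by (auto simp: cutoff_def)
  then have "sqnorm x = sqnorm (cutoff (- F) x) + sqnorm (cutoff F x) + 2 * Re (ip (cutoff (- F) x) (cutoff F x))"
    using sqnorm_add[of "cutoff (- F) x" "cutoff F x"] x by (simp add: cutoff_ell2)
  moreover have "(\<Sum>v\<in>F. cutoff (- F) x v * cnj (x v)) = 0"
    by (rule sum.neutral) (simp add: cutoff_def)
  then have "ip (cutoff (- F) x) (cutoff F x) = 0"
    by (simp add: ip_cutoff_finite F x cutoff_ell2)
  moreover have "(\<Sum>v\<in>F. cutoff F x v * cnj (x v)) = of_real (\<Sum>v\<in>F. (cmod (x v))\<^sup>2)"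
    unfolding of_real_sum complex_norm_square by (rule sum.cong) (simp_all add: cutoff_def)
  then have "sqnorm (cutoff F x) = weight * (\<Sum>v\<in>F. (cmod (x v))\<^sup>2)"
    by (simp add: sqnorm_def ip_cutoff_finite F x cutoff_ell2)
  ultimately show ?thesis by simp
qed

lemma sqnorm_split_branches:
  assumes \<beta>: "branch_index adj r \<beta>" and A: "infinite A" and x: "x \<in> ell2"
  shows "sqnorm x = weight * (cmod (x r))\<^sup>2
    + sqnorm (cutoff (branches r \<beta> A) x) + sqnorm (cutoff (branches r \<beta> (- A)) x)"
proof -
  have "ip (cutoff (branches r \<beta> A) x) (cutoff (branches r \<beta> (- A)) x) = 0"
    by (rule ip_eq_zero[OF \<beta> A], simp add: x cutoff_ell2)
      (auto simp: x cutoff_ell2, auto simp: cutoff_def branches_def)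
  moreover have "cutoff (- {r}) x = (\<lambda>v. cutoff (branches r \<beta> A) x v + cutoff (branches r \<beta> (- A)) x v)"
    by (auto simp: cutoff_def branches_def)
  ultimately have "sqnorm (cutoff (- {r}) x)
      = sqnorm (cutoff (branches r \<beta> A) x) + sqnorm (cutoff (branches r \<beta> (- A)) x)"
    by (simp add: sqnorm_add x cutoff_ell2)
  then show ?thesis
    using sqnorm_split_finite[of "{r}" x] x by simp
qed

lemma sqnorm_ge:
  assumes x: "x \<in> ell2"
  shows "weight * (\<Sum>\<^sub>\<infinity>v. (cmod (x v))\<^sup>2) \<le> sqnorm x"
proof -
  have "(\<Sum>\<^sub>\<infinity>v. (cmod (x v))\<^sup>2) \<le> sqnorm x / weight"
  proof (rule infsum_le_finite_sums)
    show "(\<lambda>v. (cmod (x v))\<^sup>2) summable_on UNIV"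
      using x by (simp add: ell2_def)
    fix F :: "'v set" assume "finite F"
    from sqnorm_split_finite[OF this x] sqnorm_nonneg[OF cutoff_ell2[OF x]]
    show "(\<Sum>v\<in>F. (cmod (x v))\<^sup>2) \<le> sqnorm x / weight"
      using weight_pos by (simp add: field_simps)
  qed
  then show ?thesis using weight_pos by (simp add: field_simps)
qed

text \<open>
  The upper bound is where discontinuity has to be excluded, and it comes from a gliding hump. If it
  fails for \<open>x\<close> by \<open>d > 0\<close>, then cutting off finitely many values leaves vectors of arbitrarily
  small usual norm whose squared \<open>ip\<close>-length is still at least \<open>d\<close>, since finite parts already
  obey the claimed equality. Enlarged copies of these tails are moved by automorphisms to pairwise
  disjoint infinite sets \<open>C n\<close> of branches, where they can be summed to one vector \<open>y\<close>. Parts of \<open>y\<close>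
  on complementary sets of branches are orthogonal, so the length of \<open>y\<close> dominates the length of
  every single piece, which is unbounded.
\<close>

lemma sqnorm_le_on_branches:
  assumes \<beta>: "branch_index adj r \<beta>" and A: "infinite A" "infinite (- A)"
    and x: "x \<in> ell2" "\<And>v. v \<notin> branches r \<beta> A \<Longrightarrow> x v = 0"
  shows "sqnorm x \<le> weight * (\<Sum>\<^sub>\<infinity>v. (cmod (x v))\<^sup>2)"
proof (rule ccontr)
  define d where "d = sqnorm x - weight * (\<Sum>\<^sub>\<infinity>v. (cmod (x v))\<^sup>2)"
  assume "\<not> ?thesis"
  then have d: "0 < d" by (simp add: d_def)
  have rest: "d \<le> sqnorm (cutoff (- F) x)" if "finite F" for F
  proof -
    have "(\<Sum>v\<in>F. (cmod (x v))\<^sup>2) \<le> (\<Sum>\<^sub>\<infinity>v. (cmod (x v))\<^sup>2)"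
      using that x(1) by (intro finite_sum_le_infsum) (auto simp: ell2_def)
    then have "weight * (\<Sum>v\<in>F. (cmod (x v))\<^sup>2) \<le> weight * (\<Sum>\<^sub>\<infinity>v. (cmod (x v))\<^sup>2)"
      using weight_pos by (intro mult_left_mono) auto
    then show ?thesis
      using sqnorm_split_finite[OF that x(1)] by (simp add: d_def)
  qed
  obtain C :: "nat \<Rightarrow> nat set" where C: "pairwise (\<lambda>i j. disjnt (C i) (C j)) UNIV"
    "\<And>n. infinite (C n)"
    using infinite_infinite_partition[OF infinite_UNIV_nat] by metis
  have disj: "i = j" if "k \<in> C i" "k \<in> C j" for i j k
    using pairwiseD[OF C(1), of i j] that by (auto simp: disjnt_iff)
  have C': "infinite (- C n)" for n
  proof -
    have "C (Suc n) \<subseteq> - C n" using disj by fastforce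
    then show ?thesis using C(2) infinite_super by blast
  qed
  \<comment> \<open>The tail must remain summable after enlargement by \<open>Suc n\<close>: the scaled tail has usual norm
    at most \<open>(1/2)^n\<close>.\<close>
  have "\<exists>F. finite F \<and> sq_bounded (cutoff (- F) x) ((1 / (Suc n * 2 ^ n))\<^sup>2)" for n
  proof -
    have "0 < (1 / real (Suc n * 2 ^ n))\<^sup>2"
      by (intro zero_less_power divide_pos_pos of_nat_0_less_iff[THEN iffD2] mult_pos_pos) simp_all
    then show ?thesis by (rule ell2_tail[OF x(1)])
  qed
  then obtain F where F: "\<And>n. finite (F n)"
    "\<And>n. sq_bounded (cutoff (- F n) x) ((1 / (Suc n * 2 ^ n))\<^sup>2)"
    by metis
  have "\<exists>g\<in>graph_Aut adj. bij g \<and> g ` branches r \<beta> A = branches r \<beta> (C n)" for n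
  proof -
    obtain \<sigma> where \<sigma>: "bij \<sigma>" "\<sigma> ` A = C n"
      by (rule exists_bij_extending[of A UNIV "C n"]) (use A C C' in \<open>auto simp: Compl_eq_Diff_UNIV\<close>)
    show ?thesis
      using permuting_automorphism[OF \<beta> \<sigma>(1)] unfolding \<sigma>(2)[symmetric] by blast
  qed
  then obtain g where g: "\<And>n. g n \<in> graph_Aut adj" "\<And>n. bij (g n)"
    "\<And>n. g n ` branches r \<beta> A = branches r \<beta> (C n)"
    by metis
  define z where "z n = (\<lambda>v. of_nat (Suc n) * cutoff (- F n) x v)" for n
  define f where "f n = lam (g n) (z n)" for n
  have z: "z n \<in> ell2" for n
    by (simp add: z_def ell2_scale cutoff_ell2 x)
  have "sq_bounded (f n) (((1 / 2) ^ n)\<^sup>2)" for n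
  proof -
    have "sq_bounded (z n) ((cmod (of_nat (Suc n)))\<^sup>2 * (1 / (Suc n * 2 ^ n))\<^sup>2)"
      unfolding z_def by (rule sq_bounded_scale[OF F(2)])
    moreover have "(cmod (of_nat (Suc n)))\<^sup>2 * (1 / (Suc n * 2 ^ n))\<^sup>2 = ((1 / 2) ^ n)\<^sup>2"
      unfolding norm_of_nat power_mult_distrib[symmetric] of_nat_mult
      by (simp add: power_one_over del: of_nat_Suc)
    ultimately show ?thesis
      unfolding f_def using sq_bounded_lam[OF g(2)] by metis
  qed
  then have sum_ell2: "(\<lambda>v. \<Sum>n. f n v) \<in> ell2"
    by (rule ell2_suminf) (auto simp: summable_geometric)
  define y where "y = (\<lambda>v. \<Sum>n. f n v)"
  have y: "y \<in> ell2" unfolding y_def by (rule sum_ell2)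
  have f_supp: "f n v = 0" if "v \<notin> branches r \<beta> (C n)" for n v
  proof -
    have "inv (g n) v \<notin> branches r \<beta> A"
      using that g(3)[of n] g(2)[of n] by (metis bij_is_surj image_eqI surj_f_inv_f)
    then show ?thesis by (simp add: f_def lam_def z_def cutoff_def x)
  qed
  have "cutoff (branches r \<beta> (C n)) y = f n" for n
  proof
    fix v
    show "cutoff (branches r \<beta> (C n)) y v = f n v"
    proof (cases "v \<in> branches r \<beta> (C n)")
      case True
      have "f m v = 0" if "m \<noteq> n" for m
        using True that disj by (intro f_supp) (auto simp: branches_def)
      then have "y v = (\<Sum>m\<in>{n}. f m v)"
        unfolding y_def by (intro suminf_finite) auto
      then show ?thesis using True by (simp add: cutoff_def)
    next
      case False
      then show ?thesis by (simp add: cutoff_def f_supp)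
    qed
  qed
  moreover have "sqnorm (cutoff (branches r \<beta> (C n)) y) \<le> sqnorm y" for n
  proof -
    have "0 \<le> weight * (cmod (y r))\<^sup>2"
      using weight_pos by simp
    then show ?thesis
      using sqnorm_split_branches[OF \<beta> C(2)[of n] y]
        sqnorm_nonneg[OF cutoff_ell2[OF y, of "branches r \<beta> (- C n)"]] by linarith
  qed
  ultimately have bound: "sqnorm (f n) \<le> sqnorm y" for n by simp
  have "real n * d \<le> sqnorm y" for n
  proof -
    have "real n * d \<le> (real (Suc n))\<^sup>2 * d"
      using d by (intro mult_right_mono) (auto simp: power2_eq_square algebra_simps)
    also have "\<dots> \<le> (cmod (of_nat (Suc n)))\<^sup>2 * sqnorm (cutoff (- F n) x)"
      unfolding norm_of_nat by (intro mult_left_mono rest F) auto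
    also have "\<dots> = sqnorm (f n)"
      unfolding f_def sqnorm_lam[OF g(1) z] unfolding z_def by (simp only: sqnorm_scale cutoff_ell2 x)
    finally show ?thesis using bound[of n] by simp
  qed
  moreover obtain n where "sqnorm y < real n * d"
    using reals_Archimedean3[OF d] by blast
  ultimately show False by (meson not_le)
qed

end

theorem theorem24:
  fixes adj :: "'v \<Rightarrow> 'v \<Rightarrow> bool"
  assumes "aleph0_regular_tree adj"
  shows "inner_product_on ell2 (ell2_inner :: ('v \<Rightarrow> complex) \<Rightarrow> ('v \<Rightarrow> complex) \<Rightarrow> complex) \<and>
         lam_Aut_invariant adj ell2_inner \<and>
         (\<forall>ip. inner_product_on ell2 ip \<and> lam_Aut_invariant adj ip \<longrightarrow>
            (\<exists>c>0. \<forall>x\<in>ell2. \<forall>y\<in>ell2. ip x y = complex_of_real c * ell2_inner x y))"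
proof (intro conjI allI impI)
  show "inner_product_on ell2 (ell2_inner :: ('v \<Rightarrow> complex) \<Rightarrow> ('v \<Rightarrow> complex) \<Rightarrow> complex)"
    by (rule inner_product_on_ell2_inner)
  show "lam_Aut_invariant adj ell2_inner"
    by (rule lam_Aut_invariant_ell2_inner)
  fix ip :: "('v \<Rightarrow> complex) \<Rightarrow> ('v \<Rightarrow> complex) \<Rightarrow> complex"
  assume ip: "inner_product_on ell2 ip \<and> lam_Aut_invariant adj ip"
  interpret I: invariant_inner_product adj ip
    using assms ip by unfold_locales auto
  interpret std: invariant_inner_product adj ell2_inner
    using assms inner_product_on_ell2_inner lam_Aut_invariant_ell2_inner by unfold_locales
  have std: "std.sqnorm x = (\<Sum>\<^sub>\<infinity>v. (cmod (x v))\<^sup>2)" if "x \<in> ell2" for x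
    using that by (simp add: std.sqnorm_def ell2_inner_self)
  have std_weight: "std.weight = 1"
  proof -
    have "(\<Sum>\<^sub>\<infinity>v. (cmod (delta (undefined :: 'v) v))\<^sup>2)
        = (\<Sum>\<^sub>\<infinity>v\<in>{undefined :: 'v}. (cmod (delta undefined v))\<^sup>2)"
      by (rule infsum_cong_neutral) (auto simp: delta_def)
    then show ?thesis
      by (simp add: std.weight_def std delta_ell2) (simp add: delta_def)
  qed
  \<comment> \<open>The upper bound holds on any infinite, co-infinite set of branches, hence on two complementary
    ones; both inner products split in the same way along these and the root.\<close>
  have sqnorm: "I.sqnorm x = I.weight * std.sqnorm x" if x: "x \<in> ell2" for x
  proof (rule antisym)
    fix r :: 'v
    obtain \<beta> where \<beta>: "branch_index adj r \<beta>"
      by (rule branch_index_exists[OF assms])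
    obtain A :: "nat set" where A: "infinite A" "infinite (UNIV - A)"
      using infinite_split[OF infinite_UNIV_nat] by metis
    then have A': "infinite (- A)" by (simp add: Compl_eq_Diff_UNIV)
    let ?a = "cutoff (branches r \<beta> A) x" and ?b = "cutoff (branches r \<beta> (- A)) x"
    have "I.sqnorm ?a \<le> I.weight * std.sqnorm ?a"
      using I.sqnorm_le_on_branches[OF \<beta> A(1) A', of ?a] by (simp add: std x cutoff_ell2) (simp add: cutoff_def)
    moreover have "I.sqnorm ?b \<le> I.weight * std.sqnorm ?b"
      using I.sqnorm_le_on_branches[OF \<beta> A', of ?b] A(1) by (simp add: std x cutoff_ell2) (simp add: cutoff_def)
    ultimately show "I.sqnorm x \<le> I.weight * std.sqnorm x"
      unfolding I.sqnorm_split_branches[OF \<beta> A(1) x] std.sqnorm_split_branches[OF \<beta> A(1) x] std_weight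
      by (simp add: distrib_left)
    show "I.weight * std.sqnorm x \<le> I.sqnorm x"
      using I.sqnorm_ge[OF x] by (simp add: std x)
  qed
  \<comment> \<open>Polarization; the imaginary part follows from the real part for \<open>\<i> x\<close>.\<close>
  have re: "Re (ip x y) = I.weight * Re (ell2_inner x y)" if "x \<in> ell2" "y \<in> ell2" for x y
    using that sqnorm[of x] sqnorm[of y] sqnorm[of "\<lambda>v. x v + y v"]
    by (simp add: ell2_add I.sqnorm_add std.sqnorm_add algebra_simps)
  have "ip x y = I.weight * ell2_inner x y" if x: "x \<in> ell2" and y: "y \<in> ell2" for x y
  proof (rule complex_eqI)
    show "Re (ip x y) = Re (I.weight * ell2_inner x y)"
      using re[OF x y] by simp
    show "Im (ip x y) = Im (I.weight * ell2_inner x y)"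
      using re[OF ell2_scale[OF x, of \<i>] y] by (simp add: I.scale_left std.scale_left x y)
  qed
  then show "\<exists>c>0. \<forall>x\<in>ell2. \<forall>y\<in>ell2. ip x y = complex_of_real c * ell2_inner x y"
    using I.weight_pos by blast
qed

end
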